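(* Let $n$ be a positive integer and let $\mathcal{A}=(a_{ij})_{1\le i,j\le n}$ be a matrix of complex constants with determinant $|\mathcal{A}|\neq 0$. Suppose that $u$ is an entire function on $\mathbb{C}^n$ satisfying $$\prod_{i=1}^n\left(a_{i1}u_{z_1}+a_{i2}u_{z_2}+\cdots+a_{in}u_{z_n}\right)=1$$ on $\mathbb{C}^n$. Then $u$ is a linear function.
   Context: An entire function on $\mathbb{C}^n$ is a holomorphic function $u:\mathbb{C}^n\to\mathbb{C}$ of $z=(z_1,\dots,z_n)$, and $u_{z_j}=\partial u/\partial z_j$ denotes the complex partial derivative. "Linear function" means a function of the form $c_0+c_1z_1+\cdots+c_nz_n$ with complex constants $c_0,\dots,c_n$ (a constant term is allowed). *)

theory Defs
  imports "HOL-Analysis.Analysis"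
begin

text \<open>Holomorphy in several variables is complex Frechet differentiability. The derivative
  in \<open>has_derivative\<close> is only real-linear, so complex homogeneity is required separately.\<close>

definition entire :: "(complex ^ 'n \<Rightarrow> complex) \<Rightarrow> bool" where
  "entire u \<longleftrightarrow>
    (\<forall>z. \<exists>L. (u has_derivative L) (at z) \<and> (\<forall>c v. L (c *s v) = c * L v))"

definition partial_deriv :: "'n \<Rightarrow> (complex ^ 'n \<Rightarrow> complex) \<Rightarrow> complex ^ 'n \<Rightarrow> complex" where
  "partial_deriv j u z = deriv (\<lambda>t. u (\<chi> k. if k = j then t else z $ k)) (z $ j)"

text \<open>A constant term is allowed, unlike in the library's \<open>linear\<close>.\<close>

definition linear_function :: "(complex ^ 'n \<Rightarrow> complex) \<Rightarrow> bool" where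
  "linear_function u \<longleftrightarrow>
    (\<exists>(c0 :: complex) (c :: complex ^ 'n). \<forall>z. u z = c0 + (\<Sum>j\<in>UNIV. c $ j * z $ j))"

end

theory Submission
  imports Defs "HOL-Complex_Analysis.Complex_Analysis" "HOL-Real_Asymp.Real_Asymp"
begin

text \<open>Let \<open>v\<^sub>i\<close> be the \<open>i\<close>-th row of the matrix and
  \<open>f\<^sub>i\<close> the derivative of \<open>u\<close> in direction
  \<open>v\<^sub>i\<close>. The equation says that the \<open>f\<^sub>i\<close> have product 1,
  so no \<open>f\<^sub>i\<close> has a zero, and the symmetry of second derivatives says that
  the logarithmic derivatives
  \<open>L\<^sub>i\<^sub>j = (D\<^bsub>v\<^sub>j\<^esub> f\<^sub>i) / f\<^sub>i\<close> satisfy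
  \<open>L\<^sub>i\<^sub>j f\<^sub>i = L\<^sub>j\<^sub>i f\<^sub>j\<close>. The rows are a
  basis, so it is enough to show that every \<open>f\<^sub>i\<close> is constant: then the
  gradient of \<open>u\<close> is constant.

  The mechanism is the one behind Nevanlinna's lemma on the logarithmic derivative:
  \<open>L\<^sub>i\<^sub>j\<close> is only as large as \<open>ln \<bar>f\<^sub>i\<bar>\<close>
  (lemma \<open>norm_log_deriv_le\<close>), and the quotient
  \<open>f\<^sub>i / f\<^sub>j\<close> equals
  \<open>L\<^sub>j\<^sub>i / L\<^sub>i\<^sub>j\<close> unless these functions vanish
  identically. A zero-free entire function that is a quotient of two functions bounded by
  \<open>M\<close> has logarithm of size about \<open>ln M\<close> (lemma
  \<open>Re_le_of_bounded_quotient\<close>). So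
  \<open>ln \<bar>f\<^sub>i / f\<^sub>j\<bar>\<close> is of the order of the logarithm of the
  numbers \<open>ln \<bar>f\<^sub>k\<bar>\<close>.

  To return from quotients to the functions themselves, join \<open>i\<close> and
  \<open>j\<close> by an edge if \<open>L\<^sub>i\<^sub>j\<close> is not identically zero. The
  product of the \<open>f\<^sub>k\<close> over a connected component is constant: in a direction
  outside the component no factor varies, and in a direction inside it only the factors of the
  component vary, while the full product is 1. Within a component all quotients are under
  control along paths, hence so is each \<open>f\<^sub>i\<close>. If \<open>B r\<close> denotes
  the maximum of \<open>1 + \<Sum>\<^sub>i \<bar>ln \<bar>f\<^sub>i\<bar>\<bar>\<close> over a
  ball of radius \<open>r\<close>, this gives
  \<open>\<sigma> B(r) \<le> K (ln B(r (1 + 2\<sigma>)) + ln (1/\<sigma>) + 1)\<close> for all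
  \<open>r \<ge> 1\<close> and \<open>0 < \<sigma> \<le> 1\<close>
  (lemma \<open>max_log_growth\<close>). Such a \<open>B\<close> is bounded
  (lemma \<open>bounded_of_logarithmic_growth_estimate\<close>), and Liouville's theorem finishes the proof.\<close>

section \<open>Estimates in one complex variable\<close>

text \<open>If \<open>b\<close> had no zeros, then
  \<open>Re h \<le> ln M - ln \<bar>b\<bar>\<close> on the disc, and Harnack's inequality for
  the right-hand side would give the claim. In general, let \<open>k\<close> be the Poisson
  kernel of the unit circle at \<open>a\<close>, scaled to take values in \<open>[0, 1]\<close>.
  There is a holomorphic \<open>P\<close> whose real part equals \<open>k Re h\<close> on the
  circle. Hence \<open>\<bar>b exp P\<bar>\<close> lies between \<open>\<bar>b\<bar>\<close> and
  \<open>\<bar>b exp h\<bar>\<close> there and so is at most \<open>M\<close>; the maximum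
  principle bounds it at 0, where \<open>P\<close> is \<open>Re (h a)\<close> times the mean
  \<open>(1 - a) / (1 + a)\<close> of \<open>k\<close>.\<close>
lemma Re_le_of_bounded_quotient:
  fixes b h :: "complex \<Rightarrow> complex" and a M :: real
  assumes S: "open S" "cball 0 1 \<subseteq> S" and b: "b holomorphic_on S" and h: "h holomorphic_on S"
    and a: "0 \<le> a" "a < 1"
    and bM: "\<And>t. cmod t = 1 \<Longrightarrow> cmod (b t) \<le> M"
    and bhM: "\<And>t. cmod t = 1 \<Longrightarrow> cmod (b t * exp (h t)) \<le> M"
    and b0: "b 0 \<noteq> 0"
  shows "(1 - a) / (1 + a) * Re (h (of_real a)) \<le> ln M - ln (cmod (b 0))"
proof -
  define q where "q = (\<lambda>t. if t = of_real a then deriv h (of_real a)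
                           else (h t - h (of_real a)) / (t - of_real a))"
  have aS: "complex_of_real a \<in> S" using S(2) a by (auto simp: subset_iff)
  have q: "q holomorphic_on S" unfolding q_def
    by (rule pole_lemma_open[OF h S(1)])
  have hq: "h t - h (of_real a) = (t - of_real a) * q t" for t
    by (auto simp: q_def)
  define c where "c = (1 - a) / (1 + a)"
  \<comment> \<open>On the unit circle the kernel is both
      \<open>c Re ((1 + a t) / (1 - a t))\<close> and
      \<open>(1 - a)\<^sup>2 t / ((t - a) (1 - a t))\<close>. The first form multiplies the
      constant \<open>Re (h a)\<close>; the second multiplies \<open>h t - h a\<close>, whose
      factor \<open>t - a\<close> cancels the pole.\<close>
  define P where "P = (\<lambda>t. of_real (c * Re (h (of_real a))) * (1 + of_real a * t) / (1 - of_real a * t)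
       + of_real ((1 - a)^2) * t * q t / (1 - of_real a * t))"
  have nz: "1 - of_real a * t \<noteq> 0" if "cmod t \<le> 1" for t
  proof
    assume "1 - of_real a * t = 0"
    then have "cmod (of_real a * t) = 1" by (metis eq_iff_diff_eq_0 norm_one)
    then have "a * cmod t = 1" using a by (simp add: norm_mult)
    moreover have "a * cmod t \<le> a * 1" using a that by (intro mult_left_mono) auto
    ultimately show False using a by simp
  qed
  have Phol: "P holomorphic_on cball 0 1"
    unfolding P_def using nz
    by (intro holomorphic_intros holomorphic_on_subset[OF q S(2)]) auto
  define F where "F = (\<lambda>t. b t * exp (P t))"
  have Fhol: "F holomorphic_on cball 0 1"
    unfolding F_def by (intro holomorphic_intros holomorphic_on_subset[OF b S(2)] Phol)
  have ReP: "Re (P t) = (1 - a)^2 / (cmod (t - of_real a))^2 * Re (h t)" if t: "cmod t = 1" for t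
  proof -
    have tt: "t * cnj t = 1" using t by (simp add: complex_norm_square[symmetric])
    define d where "d = (cmod (t - of_real a))^2"
    have dd: "of_real d = (t - of_real a) * (cnj t - of_real a)"
      unfolding d_def complex_norm_square by simp
    have e1: "(t - of_real a) * (1 - of_real a * t) = t * of_real d"
      unfolding dd using tt by (simp add: algebra_simps)
    have e2: "(1 - of_real a * t) * (1 - of_real a * cnj t) = of_real d"
      unfolding dd using tt by (simp add: algebra_simps)
    have ta: "t - of_real a \<noteq> 0" using t a by auto
    then have d0: "d > 0" unfolding d_def by simp
    have n1: "1 - of_real a * t \<noteq> 0" using nz t by simp
    have f1: "t / (1 - of_real a * t) * q t = (h t - h (of_real a)) / of_real d"
    proof -
      have "t / (1 - of_real a * t) = (t - of_real a) / of_real d"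
        using e1 n1 d0 by (simp add: field_simps)
      then show ?thesis using hq[of t] by simp
    qed
    have f2: "(1 + of_real a * t) / (1 - of_real a * t)
                = (1 + of_real a * t) * (1 - of_real a * cnj t) / of_real d"
      unfolding e2[symmetric] using n1 d0 e2
      by (metis of_real_eq_0_iff less_irrefl mult_eq_0_iff nonzero_mult_divide_mult_cancel_right)
    have f3: "Re ((1 + of_real a * t) * (1 - of_real a * cnj t)) = 1 - a^2"
    proof -
      have "(Re t)^2 + (Im t)^2 = 1" using t by (metis cmod_power2 power_one)
      then have "a * (a * (Re t)^2) + a * (a * (Im t)^2) = a^2"
        by (metis distrib_left mult.right_neutral power2_eq_square)
      then show ?thesis by (simp add: algebra_simps power2_eq_square)
    qed
    define W V where "W = (1 + of_real a * t) * (1 - of_real a * cnj t)" and "V = h t - h (of_real a)"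
    have "P t = of_real (c * Re (h (of_real a)) / d) * W + of_real ((1 - a)^2 / d) * V"
      using f1 f2 unfolding P_def W_def V_def
      by (simp only: times_divide_eq_right[symmetric] times_divide_eq_left[symmetric] mult.assoc) simp
    then have "Re (P t) = c * Re (h (of_real a)) / d * Re W + (1 - a)^2 / d * Re V"
      by simp
    then have "Re (P t) = c * Re (h (of_real a)) * ((1 - a^2) / d) + (1 - a)^2 * ((Re (h t) - Re (h (of_real a))) / d)"
      using f3 unfolding W_def V_def by simp
    also have "c * (1 - a^2) = (1 - a)^2"
      unfolding c_def using a by (simp add: power2_eq_square field_simps)
    then have "c * Re (h (of_real a)) * ((1 - a^2) / d) = (1 - a)^2 * Re (h (of_real a)) / d"
      by (simp add: mult.commute mult.left_commute)
    finally show ?thesis unfolding d_def[symmetric] by (simp add: right_diff_distrib diff_divide_distrib)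
  qed
  have Fle: "cmod (F t) \<le> M" if t: "cmod t = 1" for t
  proof -
    define k where "k = (1 - a)^2 / (cmod (t - of_real a))^2"
    have "cmod t - cmod (of_real a) \<le> cmod (t - of_real a)" by (rule norm_triangle_ineq2)
    then have "1 - a \<le> cmod (t - of_real a)" using t a by simp
    then have k: "0 \<le> k" "k \<le> 1"
      unfolding k_def using a by (auto simp: divide_le_eq power_mono)
    have F: "cmod (F t) = cmod (b t) * exp (k * Re (h t))"
      unfolding F_def by (simp add: norm_mult ReP[OF t] k_def)
    show ?thesis
    proof (cases "Re (h t) \<le> 0")
      case True
      then have "exp (k * Re (h t)) \<le> 1" using k by (simp add: mult_nonneg_nonpos)
      then have "cmod (F t) \<le> cmod (b t)" unfolding F by (simp add: mult_left_le)
      then show ?thesis using bM[OF t] by simp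
    next
      case False
      then have "exp (k * Re (h t)) \<le> exp (Re (h t))" using k by (simp add: mult_left_le_one_le)
      then have "cmod (F t) \<le> cmod (b t * exp (h t))" unfolding F by (simp add: norm_mult mult_left_mono)
      then show ?thesis using bhM[OF t] by simp
    qed
  qed
  have "cmod (F 0) \<le> M"
  proof (rule maximum_modulus_frontier[where S = "cball 0 1" and f = F and \<xi> = 0])
    show "F holomorphic_on interior (cball 0 1)"
      using Fhol by (rule holomorphic_on_subset) auto
    show "continuous_on (closure (cball 0 1)) F"
      using Fhol by (simp add: holomorphic_on_imp_continuous_on)
  qed (use Fle in auto)
  moreover have "cmod (F 0) = cmod (b 0) * exp (c * Re (h (of_real a)))"
    by (simp add: F_def P_def norm_mult)
  ultimately have le: "cmod (b 0) * exp (c * Re (h (of_real a))) \<le> M" by simp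
  have "cmod (b 0) * exp (c * Re (h (of_real a))) > 0" using b0 by simp
  then have "ln (cmod (b 0) * exp (c * Re (h (of_real a)))) \<le> ln M"
    using le by (simp only: ln_le_cancel_iff)
  then show ?thesis using b0 unfolding c_def[symmetric] by (simp add: ln_mult)
qed

text \<open>For \<open>f = exp g\<close> the root \<open>exp (g / B)\<close> lies between
  \<open>exp (-1)\<close> and \<open>exp 1\<close> in modulus, so Cauchy's inequality for it
  bounds \<open>g' / B\<close> by an absolute constant. This makes the bound linear in
  \<open>B\<close>.\<close>
lemma log_deriv_le:
  fixes f :: "complex \<Rightarrow> complex" and B \<rho> :: real
  assumes f: "f holomorphic_on UNIV" and nz: "\<And>t. f t \<noteq> 0" and \<rho>: "0 < \<rho>" and B: "0 < B"
    and le: "\<And>t. cmod t \<le> \<rho> \<Longrightarrow> \<bar>ln (cmod (f t))\<bar> \<le> B"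
  shows "cmod (deriv f 0 / f 0) \<le> exp 2 * B / \<rho>"
proof -
  obtain g where g: "g holomorphic_on UNIV" and fg: "\<And>t. f t = exp (g t)"
    using contractible_imp_holomorphic_log[OF f contractible_UNIV] nz by auto
  have Re_g: "\<bar>Re (g t)\<bar> \<le> B" if "cmod t \<le> \<rho>" for t
    using le[OF that] by (simp add: fg)
  have gd: "(g has_field_derivative deriv g t) (at t)" for t
    using g by (simp add: holomorphic_derivI)
  have "(f has_field_derivative exp (g 0) * deriv g 0) (at 0)"
    unfolding fg by (auto intro!: derivative_eq_intros gd)
  then have f': "deriv f 0 / f 0 = deriv g 0" by (simp add: DERIV_imp_deriv fg)
  define \<phi> where "\<phi> = (\<lambda>t. exp (g t / of_real B))"
  have \<phi>: "\<phi> holomorphic_on UNIV" unfolding \<phi>_def using B by (intro holomorphic_intros g) auto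
  have "(\<phi> has_field_derivative exp (g 0 / of_real B) * (deriv g 0 / of_real B)) (at 0)"
    unfolding \<phi>_def using B by (auto intro!: derivative_eq_intros gd)
  then have \<phi>': "deriv \<phi> 0 = exp (g 0 / of_real B) * (deriv g 0 / of_real B)" by (rule DERIV_imp_deriv)
  have "cmod ((deriv ^^ 1) \<phi> 0) \<le> fact 1 * exp 1 / \<rho> ^ 1"
  proof (rule Cauchy_inequality)
    show "\<phi> holomorphic_on ball 0 \<rho>" using \<phi> by (rule holomorphic_on_subset) auto
    show "continuous_on (cball 0 \<rho>) \<phi>"
      using \<phi> by (meson holomorphic_on_imp_continuous_on continuous_on_subset subset_UNIV)
    show "cmod (\<phi> x) \<le> exp 1" if "cmod (0 - x) = \<rho>" for x
      using Re_g[of x] that B by (simp add: \<phi>_def divide_le_eq)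
  qed (use \<rho> in auto)
  then have 1: "exp (Re (g 0) / B) * (cmod (deriv g 0) / B) \<le> exp 1 / \<rho>"
    using B by (simp add: \<phi>' norm_mult norm_divide)
  have "exp (-1) \<le> exp (Re (g 0) / B)"
    using Re_g[of 0] \<rho> B by (simp add: le_divide_eq)
  then have "exp (-1) * (cmod (deriv g 0) / B) \<le> exp 1 / \<rho>"
    using 1 B by (meson divide_nonneg_pos mult_right_mono norm_ge_zero order_trans)
  then have "exp 1 * (exp (-1) * (cmod (deriv g 0) / B)) \<le> exp 1 * (exp 1 / \<rho>)"
    by (intro mult_left_mono) auto
  then have "cmod (deriv g 0) / B \<le> exp 2 / \<rho>"
    by (simp add: mult.assoc[symmetric] exp_add[symmetric])
  then show ?thesis unfolding f' using B by (simp add: field_simps)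
qed

section \<open>A growth lemma\<close>

text \<open>With \<open>\<sigma> = 1 / (2 sqrt (B r))\<close> the estimate reads
  \<open>sqrt (B r) / 2 \<le> K (ln (B r') + \<dots>)\<close> for
  \<open>r' = r (1 + 1 / sqrt (B r))\<close>. Once \<open>B r\<close> is large this forces
  \<open>B r' \<ge> 4 B r\<close>. Iterating, the values grow like \<open>4\<^sup>k\<close>
  while the radii only gain factors \<open>1 + 2\<^sup>-\<^sup>k\<close>, whose product
  converges, so \<open>B\<close>
  would be infinite at a finite radius.\<close>
lemma bounded_of_logarithmic_growth_estimate:
  fixes B :: "real \<Rightarrow> real" and K :: real
  assumes mono: "\<And>r s. 1 \<le> r \<Longrightarrow> r \<le> s \<Longrightarrow> B r \<le> B s"
    and K: "0 \<le> K" and pos: "\<And>r. 1 \<le> r \<Longrightarrow> 0 < B r"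
    and est: "\<And>r \<sigma>. 1 \<le> r \<Longrightarrow> 0 < \<sigma> \<Longrightarrow> \<sigma> \<le> 1 \<Longrightarrow>
                \<sigma> * B r \<le> K * (ln (B (r * (1 + 2 * \<sigma>))) + ln (1 / \<sigma>) + 1)"
  shows "\<exists>M. \<forall>r\<ge>1. B r \<le> M"
proof -
  have "((\<lambda>x::real. (ln (4 * x) + ln (2 * sqrt x) + 1) / sqrt x) \<longlongrightarrow> 0) at_top"
    by real_asymp
  from tendsto_mult[OF tendsto_const[of K] this]
  have "((\<lambda>x::real. K * ((ln (4 * x) + ln (2 * sqrt x) + 1) / sqrt x)) \<longlongrightarrow> 0) at_top" by simp
  from order_tendstoD(2)[OF this, of "1/2"]
  obtain x0 where x0: "\<And>x. x \<ge> x0 \<Longrightarrow> K * ((ln (4 * x) + ln (2 * sqrt x) + 1) / sqrt x) < 1/2"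
    by (auto simp: eventually_at_top_linorder)
  \<comment> \<open>The 1 starts the induction for \<open>4\<^sup>k \<le> B (\<rho> k)\<close>
      below.\<close>
  define X where "X = max 1 x0"
  have step: "4 * B r \<le> B (r * (1 + 1 / sqrt (B r)))" if r: "1 \<le> r" and X: "X \<le> B r" for r
  proof (rule ccontr)
    define x where "x = B r"
    have x: "1 \<le> x" "x0 \<le> x" using X unfolding X_def x_def by auto
    define s where "s = sqrt x"
    have s: "1 \<le> s" "s * s = x" using x unfolding s_def by auto
    define x' where "x' = B (r * (1 + 1 / s))"
    assume "\<not> 4 * B r \<le> B (r * (1 + 1 / sqrt (B r)))"
    then have x': "x' < 4 * x" unfolding x'_def s_def x_def by simp
    have x'0: "0 < x'" unfolding x'_def using r s
      by (intro pos) (auto simp: algebra_simps add_increasing2)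
    have "1 / (2 * s) * x \<le> K * (ln x' + ln (1 / (1 / (2 * s))) + 1)"
      using est[OF r, of "1 / (2 * s)"] s unfolding x_def x'_def by (simp add: divide_le_eq)
    also have "\<dots> \<le> K * (ln (4 * x) + ln (2 * s) + 1)"
      using x' x'0 s by (intro mult_left_mono K) (auto simp: ln_mono)
    finally have "s / 2 \<le> K * (ln (4 * x) + ln (2 * s) + 1)"
      using s(1) unfolding s(2)[symmetric] by simp
    moreover have "K * (ln (4 * x) + ln (2 * s) + 1) < s / 2"
      using x0[OF x(2)] s unfolding s_def[symmetric] by (simp add: divide_less_eq)
    ultimately show False by simp
  qed
  have "B r \<le> X" if r1: "1 \<le> r" for r
  proof (rule ccontr)
    assume "\<not> B r \<le> X"
    then have r2: "X \<le> B r" by simp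
    define \<rho> where "\<rho> = rec_nat r (\<lambda>_ s. s * (1 + 1 / sqrt (B s)))"
    have \<rho>0: "\<rho> 0 = r" and \<rho>S: "\<rho> (Suc k) = \<rho> k * (1 + 1 / sqrt (B (\<rho> k)))" for k
      by (auto simp: \<rho>_def)
    have inv: "1 \<le> \<rho> k \<and> X \<le> B (\<rho> k) \<and> 4 ^ k \<le> B (\<rho> k)
                 \<and> \<rho> k \<le> r * exp (\<Sum>i<k. (1/2) ^ i)" for k
    proof (induction k)
      case 0
      show ?case using r1 r2 by (auto simp: \<rho>0 X_def)
    next
      case (Suc k)
      define x where "x = B (\<rho> k)"
      have IH: "1 \<le> \<rho> k" "X \<le> x" "4 ^ k \<le> x" "\<rho> k \<le> r * exp (\<Sum>i<k. (1/2) ^ i)"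
        using Suc unfolding x_def by auto
      have x1: "1 \<le> x" using IH(2) unfolding X_def by simp
      have S: "\<rho> (Suc k) = \<rho> k * (1 + 1 / sqrt x)" using \<rho>S unfolding x_def .
      have 4: "4 * x \<le> B (\<rho> (Suc k))" using step[OF IH(1)] IH(2) S unfolding x_def by simp
      have "1 * 1 \<le> \<rho> (Suc k)" unfolding S using IH(1) x1 by (intro mult_mono) auto
      moreover have "X \<le> B (\<rho> (Suc k))" using 4 IH(2) x1 by linarith
      moreover have "4 ^ Suc k \<le> B (\<rho> (Suc k))" using 4 IH(3) by simp
      moreover have "\<rho> (Suc k) \<le> r * exp (\<Sum>i<Suc k. (1/2) ^ i)"
      proof -
        have "sqrt (4 ^ k) \<le> sqrt x" using IH(3) by simp
        then have "2 ^ k \<le> sqrt x" by (simp add: real_sqrt_power)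
        then have "1 / sqrt x \<le> 1 / 2 ^ k" by (intro divide_left_mono) (use x1 in auto)
        then have "1 + 1 / sqrt x \<le> 1 + (1/2) ^ k" by (simp add: power_one_over)
        also have "\<dots> \<le> exp ((1/2) ^ k)" by (rule exp_ge_add_one_self)
        finally have "\<rho> k * (1 + 1 / sqrt x) \<le> (r * exp (\<Sum>i<k. (1/2) ^ i)) * exp ((1/2) ^ k)"
          using IH x1 r1 by (intro mult_mono) auto
        then show ?thesis unfolding S by (simp add: exp_add mult.assoc)
      qed
      ultimately show ?case by simp
    qed
    have "4 ^ k \<le> B (r * exp 2)" for k :: nat
    proof -
      have "(\<Sum>i<k. (1/2::real) ^ i) \<le> 2" by (simp add: geometric_sum)
      then have "r * exp (\<Sum>i<k. (1/2) ^ i) \<le> r * exp 2"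
        using r1 by (intro mult_left_mono) auto
      then have "B (\<rho> k) \<le> B (r * exp 2)" using inv[of k] by (intro mono) auto
      then show ?thesis using inv[of k] by linarith
    qed
    moreover obtain k :: nat where "B (r * exp 2) < 4 ^ k"
      using real_arch_pow[of 4 "B (r * exp 2)"] by auto
    ultimately show False by (meson not_less)
  qed
  then show ?thesis by blast
qed

section \<open>Functions holomorphic along complex lines\<close>

text \<open>The error depends on \<open>\<phi>\<close> only through a bound on a disc, which
  makes difference quotients of a function of several variables converge uniformly on compact
  sets.\<close>
lemma difference_quotient_error:
  fixes \<phi> :: "complex \<Rightarrow> complex"
  assumes \<phi>: "\<phi> holomorphic_on UNIV" and M: "\<And>t. cmod t \<le> 2 \<Longrightarrow> cmod (\<phi> t) \<le> M"
    and t: "t \<noteq> 0" "cmod t \<le> 1"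
  shows "cmod ((\<phi> t - \<phi> 0) / t - deriv \<phi> 0) \<le> 2 * M * cmod t"
proof -
  have d: "((deriv ^^ i) \<phi> has_field_derivative (deriv ^^ Suc i) \<phi> x) (at x within T)" for i x T
    using holomorphic_derivI[OF holomorphic_higher_deriv[OF \<phi> open_UNIV] open_UNIV, of x i T] by simp
  have B: "cmod ((deriv ^^ Suc 1) \<phi> x) \<le> 2 * M" if "x \<in> cball 0 1" for x
  proof -
    have "cmod ((deriv ^^ 2) \<phi> x) \<le> fact 2 * M / 1 ^ 2"
    proof (rule Cauchy_inequality)
      show "\<phi> holomorphic_on ball x 1" using \<phi> by (rule holomorphic_on_subset) auto
      show "continuous_on (cball x 1) \<phi>"
        using \<phi> by (meson holomorphic_on_imp_continuous_on continuous_on_subset subset_UNIV)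
      show "cmod (\<phi> y) \<le> M" if "cmod (x - y) = 1" for y
      proof (rule M)
        show "cmod y \<le> 2"
          using norm_triangle_ineq2[of y x] that \<open>x \<in> cball 0 1\<close> by (simp add: norm_minus_commute)
      qed
    qed auto
    then show ?thesis by (simp add: numeral_2_eq_2)
  qed
  have "cmod ((deriv ^^ 0) \<phi> t - (\<Sum>i\<le>1. (deriv ^^ i) \<phi> 0 * (t - 0) ^ i / fact i))
          \<le> 2 * M * cmod (t - 0) ^ Suc 1 / fact 1"
    by (rule complex_Taylor[where S = "cball 0 1"]) (use d B t in auto)
  then have "cmod (\<phi> t - \<phi> 0 - deriv \<phi> 0 * t) \<le> 2 * M * cmod t * cmod t"
    by (simp add: power2_eq_square algebra_simps)
  moreover have "\<phi> t - \<phi> 0 - deriv \<phi> 0 * t = ((\<phi> t - \<phi> 0) / t - deriv \<phi> 0) * t"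
    using t by (simp add: field_simps)
  ultimately have "cmod ((\<phi> t - \<phi> 0) / t - deriv \<phi> 0) * cmod t \<le> 2 * M * cmod t * cmod t"
    by (simp add: norm_mult)
  then show ?thesis using t by simp
qed

lemma norm_vector_scalar_mult: "norm (c *s v) = cmod c * norm v" for v :: "complex ^ 'n"
  by (simp add: norm_vec_def norm_mult L2_set_right_distrib)

lemma continuous_on_vector_scalar_mult [continuous_intros]:
  fixes f :: "'a::topological_space \<Rightarrow> complex" and g :: "'a \<Rightarrow> complex ^ 'n"
  assumes "continuous_on S f" "continuous_on S g"
  shows "continuous_on S (\<lambda>x. f x *s g x)"
  unfolding vector_scalar_mult_def by (intro continuous_intros assms)

text \<open>By Hartogs and Osgood these are the entire functions, but in this form closure under
  directional derivatives follows from one-variable theorems on uniform limits.\<close>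
definition line_holomorphic :: "(complex ^ 'n \<Rightarrow> complex) \<Rightarrow> bool" where
  "line_holomorphic f \<longleftrightarrow>
     continuous_on UNIV f \<and> (\<forall>z v. (\<lambda>t. f (z + t *s v)) holomorphic_on UNIV)"

definition dir_deriv :: "complex ^ 'n \<Rightarrow> (complex ^ 'n \<Rightarrow> complex) \<Rightarrow> complex ^ 'n \<Rightarrow> complex" where
  "dir_deriv v f z = deriv (\<lambda>t. f (z + t *s v)) 0"

lemma line_holomorphic_continuous: "line_holomorphic f \<Longrightarrow> continuous_on S f"
  unfolding line_holomorphic_def using continuous_on_subset by blast

lemma line_holomorphic_line: "line_holomorphic f \<Longrightarrow> (\<lambda>t. f (z + t *s v)) holomorphic_on S"
  unfolding line_holomorphic_def using holomorphic_on_subset by blast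

lemma line_holomorphic_const: "line_holomorphic (\<lambda>z. c)"
  unfolding line_holomorphic_def by auto

lemma line_holomorphic_diff:
  "line_holomorphic f \<Longrightarrow> line_holomorphic g \<Longrightarrow> line_holomorphic (\<lambda>z. f z - g z)"
  unfolding line_holomorphic_def by (auto intro!: continuous_intros holomorphic_intros)

lemma line_holomorphic_translate:
  assumes "line_holomorphic f" shows "line_holomorphic (\<lambda>z. f (z + w))"
  unfolding line_holomorphic_def
proof (intro conjI allI)
  show "continuous_on UNIV (\<lambda>z. f (z + w))"
    by (rule continuous_on_compose2[OF line_holomorphic_continuous[OF assms, of UNIV]])
      (auto intro!: continuous_intros)
  have "z + t *s v + w = (z + w) + t *s v" for z v t by (simp add: add_ac)
  then show "(\<lambda>t. f (z + t *s v + w)) holomorphic_on UNIV" for z v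
    by (simp only: line_holomorphic_line[OF assms])
qed

lemma line_holomorphic_divide:
  "line_holomorphic f \<Longrightarrow> line_holomorphic g \<Longrightarrow> (\<And>z. g z \<noteq> 0) \<Longrightarrow> line_holomorphic (\<lambda>z. f z / g z)"
  unfolding line_holomorphic_def by (auto intro!: continuous_intros holomorphic_intros)

lemma has_field_derivative_line:
  assumes "line_holomorphic f"
  shows "((\<lambda>t. f (z + t *s v)) has_field_derivative dir_deriv v f (z + t *s v)) (at t)"
proof -
  define \<phi> where "\<phi> = (\<lambda>t. f (z + t *s v))"
  have d: "(\<phi> has_field_derivative deriv \<phi> t) (at t)"
    using line_holomorphic_line[OF assms, of z v UNIV] unfolding \<phi>_def
    by (simp add: holomorphic_derivI)
  then have "((\<lambda>s. \<phi> (s + t)) has_field_derivative deriv \<phi> t) (at 0)"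
    using DERIV_shift[of \<phi> "deriv \<phi> t" 0 t] by simp
  then have "deriv (\<lambda>s. \<phi> (s + t)) 0 = deriv \<phi> t" by (rule DERIV_imp_deriv)
  moreover have "(\<lambda>s. \<phi> (s + t)) = (\<lambda>s. f (z + t *s v + s *s v))"
    by (simp add: \<phi>_def fun_eq_iff vector_sadd_rdistrib add_ac)
  ultimately show ?thesis using d unfolding \<phi>_def dir_deriv_def by simp
qed

definition diff_quot :: "nat \<Rightarrow> complex ^ 'n \<Rightarrow> (complex ^ 'n \<Rightarrow> complex) \<Rightarrow> complex ^ 'n \<Rightarrow> complex" where
  "diff_quot k v f z = (f (z + inverse (of_nat (Suc k)) *s v) - f z) / inverse (of_nat (Suc k))"

lemma uniform_limit_diff_quot:
  fixes f :: "complex ^ 'n \<Rightarrow> complex"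
  assumes f: "line_holomorphic f" and K: "compact K"
  shows "uniform_limit K (\<lambda>k. diff_quot k v f) (dir_deriv v f) sequentially"
proof -
  have "compact ((\<lambda>(x, t). f (x + t *s v)) ` (K \<times> cball 0 2))"
    unfolding split_beta
    by (intro compact_continuous_image compact_Times K compact_cball
        continuous_on_compose2[OF line_holomorphic_continuous[OF f, of UNIV]] continuous_intros) auto
  then obtain M where "0 < M" and M': "\<And>y. y \<in> (\<lambda>(x, t). f (x + t *s v)) ` (K \<times> cball 0 2) \<Longrightarrow> cmod y \<le> M"
    by (auto simp only: bounded_pos dest!: compact_imp_bounded)
  have M: "cmod (f (x + t *s v)) \<le> M" if "x \<in> K" "cmod t \<le> 2" for x t
    by (rule M', rule image_eqI[of _ _ "(x, t)"]) (use that in auto)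
  have err: "cmod (diff_quot k v f x - dir_deriv v f x) \<le> 2 * M * inverse (real (Suc k))"
    if "x \<in> K" for x k
  proof -
    define \<epsilon> :: complex where "\<epsilon> = inverse (of_nat (Suc k))"
    have e: "cmod \<epsilon> = inverse (real (Suc k))" unfolding \<epsilon>_def by (simp add: norm_inverse del: of_nat_Suc)
    have "\<epsilon> \<noteq> 0" "cmod \<epsilon> \<le> 1" unfolding e by (auto simp: \<epsilon>_def field_simps simp del: of_nat_Suc)
    from difference_quotient_error[OF line_holomorphic_line[OF f, of x v] M[OF that] this]
    show ?thesis unfolding diff_quot_def dir_deriv_def e \<epsilon>_def by (simp add: e[unfolded \<epsilon>_def] del: of_nat_Suc)
  qed
  have "(\<lambda>k. 2 * M * inverse (real (Suc k))) \<longlonglongrightarrow> 2 * M * 0"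
    by (intro tendsto_mult tendsto_const LIMSEQ_inverse_real_of_nat)
  then have lim: "(\<lambda>k. 2 * M * inverse (real (Suc k))) \<longlonglongrightarrow> 0" by simp
  show ?thesis
  proof (rule uniform_limitI)
    fix e :: real assume "0 < e"
    with lim have "\<forall>\<^sub>F k in sequentially. 2 * M * inverse (real (Suc k)) < e"
      by (rule order_tendstoD)
    then show "\<forall>\<^sub>F k in sequentially. \<forall>x\<in>K. dist (diff_quot k v f x) (dir_deriv v f x) < e"
    proof eventually_elim
      case (elim k)
      then show ?case using err[of _ k] unfolding dist_norm by (meson le_less_trans)
    qed
  qed
qed

lemma line_holomorphic_diff_quot:
  assumes "line_holomorphic f" shows "line_holomorphic (diff_quot k v f)"
  unfolding diff_quot_def
  by (rule line_holomorphic_divide[OF line_holomorphic_diff[OF line_holomorphic_translate[OF assms] assms]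
        line_holomorphic_const]) (simp del: of_nat_Suc)

lemma uniform_limit_diff_quot_line:
  assumes "line_holomorphic f" "compact T"
  shows "uniform_limit T (\<lambda>k t. diff_quot k v f (z + t *s w)) (\<lambda>t. dir_deriv v f (z + t *s w)) sequentially"
proof -
  have "compact ((\<lambda>t. z + t *s w) ` T)"
    using assms(2) by (intro compact_continuous_image continuous_intros)
  from uniform_limit_diff_quot[OF assms(1) this, of v]
  show ?thesis by (rule uniform_limit_compose') auto
qed

lemma line_holomorphic_dir_deriv:
  fixes f :: "complex ^ 'n \<Rightarrow> complex"
  assumes f: "line_holomorphic f"
  shows "line_holomorphic (dir_deriv v f)"
  unfolding line_holomorphic_def
proof (intro conjI allI)
  have "continuous (at x) (dir_deriv v f)" for x
  proof -
    have "continuous_on (cball x 1) (dir_deriv v f)"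
      by (rule uniform_limit_theorem[OF _ uniform_limit_diff_quot[OF f compact_cball]])
        (auto intro!: always_eventually line_holomorphic_continuous line_holomorphic_diff_quot f)
    then have "continuous_on (ball x 1) (dir_deriv v f)" by (rule continuous_on_subset) auto
    then show ?thesis by (simp add: continuous_on_eq_continuous_at)
  qed
  then show "continuous_on UNIV (dir_deriv v f)" by (simp add: continuous_on_eq_continuous_at)
  show "(\<lambda>t. dir_deriv v f (z + t *s w)) holomorphic_on UNIV" for z w
  proof (rule holomorphic_uniform_sequence)
    show "(\<lambda>t. diff_quot k v f (z + t *s w)) holomorphic_on UNIV" for k
      by (intro line_holomorphic_line line_holomorphic_diff_quot f)
    show "\<exists>d>0. cball x d \<subseteq> UNIV \<and> uniform_limit (cball x d) (\<lambda>k t. diff_quot k v f (z + t *s w))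
            (\<lambda>t. dir_deriv v f (z + t *s w)) sequentially" for x
      by (intro exI[of _ 1] conjI uniform_limit_diff_quot_line f compact_cball) auto
  qed auto
qed

text \<open>The quotients \<open>diff_quot k v f\<close> converge uniformly to the derivative in
  direction \<open>v\<close>. For uniform limits of holomorphic functions the derivatives in
  direction \<open>w\<close> converge as well, and they are the difference quotients of the
  derivative of \<open>f\<close> in direction \<open>w\<close>.\<close>
lemma dir_deriv_commute:
  fixes f :: "complex ^ 'n \<Rightarrow> complex"
  assumes f: "line_holomorphic f"
  shows "dir_deriv w (dir_deriv v f) z = dir_deriv v (dir_deriv w f) z"
proof -
  have fw: "line_holomorphic (dir_deriv w f)" by (rule line_holomorphic_dir_deriv[OF f])
  have "\<exists>g'. \<forall>x\<in>UNIV. ((\<lambda>t. dir_deriv v f (z + t *s w)) has_field_derivative g' x) (at x) \<and>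
            (\<lambda>k. diff_quot k v (dir_deriv w f) (z + x *s w)) \<longlonglongrightarrow> g' x"
  proof (rule has_complex_derivative_uniform_sequence)
    show "((\<lambda>t. diff_quot k v f (z + t *s w)) has_field_derivative
            diff_quot k v (dir_deriv w f) (z + x *s w)) (at x)" for k x
    proof -
      have "((\<lambda>t. f (z + c *s v + t *s w)) has_field_derivative dir_deriv w f (z + c *s v + x *s w)) (at x)" for c
        by (rule has_field_derivative_line[OF f])
      moreover have "z + c *s v + t *s w = z + t *s w + c *s v" for c t
        by (simp add: add_ac)
      ultimately have "((\<lambda>t. f (z + t *s w + c *s v)) has_field_derivative dir_deriv w f (z + x *s w + c *s v)) (at x)" for c
        by (simp only:)
      then show ?thesis unfolding diff_quot_def
        by (intro DERIV_cdivide DERIV_diff has_field_derivative_line[OF f])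
    qed
    show "\<exists>d>0. cball x d \<subseteq> UNIV \<and> uniform_limit (cball x d) (\<lambda>k t. diff_quot k v f (z + t *s w))
            (\<lambda>t. dir_deriv v f (z + t *s w)) sequentially" for x
      by (intro exI[of _ 1] conjI uniform_limit_diff_quot_line f compact_cball) auto
  qed auto
  then obtain G where G: "\<And>x. ((\<lambda>t. dir_deriv v f (z + t *s w)) has_field_derivative G x) (at x)"
     "\<And>x. (\<lambda>k. diff_quot k v (dir_deriv w f) (z + x *s w)) \<longlonglongrightarrow> G x"
    unfolding ball_UNIV by blast
  define g' where "g' = G 0"
  have g': "((\<lambda>t. dir_deriv v f (z + t *s w)) has_field_derivative g') (at 0)"
     "(\<lambda>k. diff_quot k v (dir_deriv w f) z) \<longlonglongrightarrow> g'"
    using G(1)[of 0] G(2)[of 0] unfolding g'_def by (simp_all only: vector_smult_lzero add_0_right)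
  have "(\<lambda>k. diff_quot k v (dir_deriv w f) z) \<longlonglongrightarrow> dir_deriv v (dir_deriv w f) z"
    using uniform_limit_diff_quot[OF fw, of "{z}"] by (auto intro: tendsto_uniform_limitI)
  with g'(2) have "g' = dir_deriv v (dir_deriv w f) z" by (rule LIMSEQ_unique)
  moreover have "dir_deriv w (dir_deriv v f) z = g'"
    unfolding dir_deriv_def[of w] using g'(1) by (rule DERIV_imp_deriv)
  ultimately show ?thesis by simp
qed

text \<open>If \<open>p\<close> works for all functions but one and \<open>q\<close> works for
  that one, then none of the restrictions to the line through \<open>p\<close> and
  \<open>q\<close> vanishes identically, so all points of this line near \<open>p\<close> and
  different from it work.\<close>
lemma ex_common_nonzero:
  fixes F :: "'a \<Rightarrow> complex ^ 'n \<Rightarrow> complex"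
  assumes "finite I" "\<And>i. i \<in> I \<Longrightarrow> line_holomorphic (F i)" "\<And>i. i \<in> I \<Longrightarrow> \<exists>z. F i z \<noteq> 0"
  shows "\<exists>z. \<forall>i\<in>I. F i z \<noteq> 0"
proof -
  have nz: "\<forall>\<^sub>F t in at 0. g t \<noteq> 0" if g: "g holomorphic_on UNIV" "g s \<noteq> 0" for g :: "complex \<Rightarrow> complex" and s
  proof (cases "g 0 = 0")
    case True
    obtain r where r: "0 < r" "\<And>z. z \<in> ball 0 r - {0} \<Longrightarrow> g z \<noteq> 0"
      by (rule isolated_zeros[OF g(1) open_UNIV connected_UNIV UNIV_I True UNIV_I g(2)], rule that)
    show ?thesis unfolding eventually_at by (intro exI[of _ r]) (use r in auto)
  next
    case False
    have "isCont g 0"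
      using g(1) holomorphic_on_imp_continuous_on continuous_on_eq_continuous_at by blast
    then show ?thesis using False tendsto_imp_eventually_ne[of g "g 0"] by (simp add: isCont_def)
  qed
  from assms show ?thesis
  proof (induction I)
    case (insert i I)
    have "\<exists>z. \<forall>i\<in>I. F i z \<noteq> 0" by (rule insert.IH[OF insert.prems(1,2)]) (rule insertI2, assumption)+
    then obtain p where p: "\<And>j. j \<in> I \<Longrightarrow> F j p \<noteq> 0" by blast
    obtain q where q: "F i q \<noteq> 0" using insert.prems(2)[of i] by blast
    have "\<forall>\<^sub>F t in at 0. F j (p + t *s (q - p)) \<noteq> 0" if "j \<in> insert i I" for j
    proof (rule nz)
      show "(\<lambda>t. F j (p + t *s (q - p))) holomorphic_on UNIV"
        using insert that by (intro line_holomorphic_line) auto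
      \<comment> \<open>The parameter is 0 at \<open>p\<close> and 1 at \<open>q\<close>.\<close>
      show "F j (p + (if j = i then 1 else 0) *s (q - p)) \<noteq> 0" using p q that by auto
    qed
    then have "\<forall>\<^sub>F t in at 0. \<forall>j\<in>insert i I. F j (p + t *s (q - p)) \<noteq> 0"
      using insert.hyps by (intro eventually_ball_finite) auto
    then show ?case using eventually_happens'[OF at_neq_bot] by blast
  qed auto
qed

section \<open>Zero-free functions on complex vector spaces\<close>

lemma norm_log_deriv_le:
  fixes f :: "complex ^ 'n \<Rightarrow> complex"
  assumes f: "line_holomorphic f" "\<And>z. f z \<noteq> 0" and \<rho>: "0 < \<rho>" and B: "0 < B"
    and le: "\<And>t. cmod t \<le> \<rho> \<Longrightarrow> \<bar>ln (cmod (f (z + t *s v)))\<bar> \<le> B"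
  shows "cmod (dir_deriv v f z / f z) \<le> exp 2 * B / \<rho>"
  using log_deriv_le[OF line_holomorphic_line[OF f(1), of z v] f(2) \<rho> B le]
  unfolding dir_deriv_def by simp

text \<open>The quotient \<open>F / G = b / a\<close> is zero-free. On the line from
  \<open>z0\<close> through \<open>z\<close>, scaled so that the unit circle has radius
  \<open>(1 + \<sigma>) \<bar>z - z0\<bar>\<close>, lemma
  \<open>Re_le_of_bounded_quotient\<close> applies to its logarithm. A lower bound for
  \<open>\<bar>a\<bar>\<close> is needed at \<open>z0\<close> alone, so zeros of
  \<open>a\<close> elsewhere do no harm.\<close>
lemma ln_norm_diff_le:
  fixes a b F G :: "complex ^ 'n \<Rightarrow> complex"
  assumes hol: "line_holomorphic a" "line_holomorphic F" "line_holomorphic G"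
    and nz: "\<And>z. F z \<noteq> 0" "\<And>z. G z \<noteq> 0"
    and eq: "\<And>z. a z * F z = b z * G z"
    and \<sigma>: "0 < \<sigma>" "\<sigma> \<le> 1" and z: "z \<in> cball z0 r"
    and M: "\<And>z. z \<in> cball z0 (r * (1 + \<sigma>)) \<Longrightarrow> cmod (a z) \<le> M \<and> cmod (b z) \<le> M"
    and a0: "a z0 \<noteq> 0"
  shows "ln (cmod (F z)) - ln (cmod (G z)) \<le> 3 / \<sigma> * (ln M - ln (cmod (a z0)))"
proof -
  define w where "w = of_real (1 + \<sigma>) *s (z - z0)"
  define \<alpha> where "\<alpha> = 1 / (1 + \<sigma>)"
  have r: "0 \<le> r" "norm (z - z0) \<le> r"
    using z by (auto simp: dist_norm norm_minus_commute intro: order_trans[OF norm_ge_zero])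
  have w: "norm w \<le> r * (1 + \<sigma>)"
    using r \<sigma> unfolding w_def norm_vector_scalar_mult
    by (simp add: mult.commute mult_left_mono del: of_real_add)
  have in_ball: "z0 + t *s w \<in> cball z0 (r * (1 + \<sigma>))" if "cmod t \<le> 1" for t
  proof -
    have "cmod t * norm w \<le> 1 * norm w" using that by (intro mult_right_mono) auto
    then show ?thesis using w by (simp add: dist_norm norm_vector_scalar_mult)
  qed
  have wz: "z0 + of_real \<alpha> *s w = z"
  proof -
    have "of_real \<alpha> * (of_real (1 + \<sigma>) :: complex) = of_real (\<alpha> * (1 + \<sigma>))" by simp
    also have "\<dots> = 1" using \<sigma> by (simp add: \<alpha>_def)
    finally show ?thesis by (simp only: w_def vector_smult_assoc vector_smult_lid) simp
  qed
  have FG: "(\<lambda>t. F (z0 + t *s w) / G (z0 + t *s w)) holomorphic_on UNIV"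
    using nz by (intro holomorphic_intros line_holomorphic_line hol) auto
  obtain h where h: "h holomorphic_on UNIV"
      and FGh: "\<And>t. F (z0 + t *s w) / G (z0 + t *s w) = exp (h t)"
    using contractible_imp_holomorphic_log[OF FG contractible_UNIV] nz by auto
  have ah: "a (z0 + t *s w) * exp (h t) = b (z0 + t *s w)" for t
    using eq[of "z0 + t *s w"] nz(2)[of "z0 + t *s w"] by (simp add: FGh[symmetric] field_simps)
  have ratio: "(1 - \<alpha>) / (1 + \<alpha>) = \<sigma> / (2 + \<sigma>)"
  proof -
    have "1 - \<alpha> = \<sigma> / (1 + \<sigma>)" "1 + \<alpha> = (2 + \<sigma>) / (1 + \<sigma>)"
      using \<sigma> by (auto simp: \<alpha>_def field_simps)
    then show ?thesis using \<sigma> by simp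
  qed
  have "(1 - \<alpha>) / (1 + \<alpha>) * Re (h (of_real \<alpha>)) \<le> ln M - ln (cmod (a (z0 + 0 *s w)))"
  proof (rule Re_le_of_bounded_quotient[where S = UNIV and b = "\<lambda>t. a (z0 + t *s w)"])
    show "(\<lambda>t. a (z0 + t *s w)) holomorphic_on UNIV" by (intro line_holomorphic_line hol)
    show "h holomorphic_on UNIV" by (rule h)
    show "0 \<le> \<alpha>" "\<alpha> < 1" using \<sigma> by (auto simp: \<alpha>_def)
    show "cmod (a (z0 + t *s w)) \<le> M" if "cmod t = 1" for t
      using M[OF in_ball] that by simp
    show "cmod (a (z0 + t *s w) * exp (h t)) \<le> M" if "cmod t = 1" for t
      unfolding ah using M[OF in_ball] that by simp
  qed (use a0 in auto)
  then have le: "\<sigma> / (2 + \<sigma>) * Re (h (of_real \<alpha>)) \<le> ln M - ln (cmod (a z0))"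
    by (simp add: ratio)
  have "cmod (a z0) \<le> M" using M[of z0] r \<sigma> by simp
  then have N: "0 \<le> ln M - ln (cmod (a z0))" using a0 by (simp add: ln_mono)
  have "Re (h (of_real \<alpha>)) = ln (cmod (F z / G z))"
    using FGh[of "of_real \<alpha>"] unfolding wz by simp
  also have "\<dots> = ln (cmod (F z)) - ln (cmod (G z))"
    using nz by (simp add: norm_divide ln_div)
  finally have "ln (cmod (F z)) - ln (cmod (G z)) = (2 + \<sigma>) / \<sigma> * (\<sigma> / (2 + \<sigma>) * Re (h (of_real \<alpha>)))"
    using \<sigma> by simp
  also have "\<dots> \<le> (2 + \<sigma>) / \<sigma> * (ln M - ln (cmod (a z0)))"
    using le \<sigma> by (intro mult_left_mono) auto
  also have "\<dots> \<le> 3 / \<sigma> * (ln M - ln (cmod (a z0)))"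
    using N \<sigma> by (intro mult_right_mono divide_right_mono) auto
  finally show ?thesis .
qed

lemma dir_deriv_prod:
  fixes f :: "'i \<Rightarrow> complex ^ 'n \<Rightarrow> complex"
  assumes "finite I" "\<And>i. line_holomorphic (f i)" "\<And>i z. f i z \<noteq> 0"
  shows "((\<lambda>t. \<Prod>i\<in>I. f i (z + t *s v)) has_field_derivative
           (\<Prod>i\<in>I. f i (z + t *s v)) * (\<Sum>i\<in>I. dir_deriv v (f i) (z + t *s v) / f i (z + t *s v))) (at t)"
  using assms(1)
proof (induction I)
  case (insert i I)
  have "((\<lambda>t. f i (z + t *s v)) has_field_derivative dir_deriv v (f i) (z + t *s v)) (at t)"
    by (rule has_field_derivative_line[OF assms(2)])
  from DERIV_mult[OF this insert.IH]
  have "((\<lambda>t. f i (z + t *s v) * (\<Prod>i\<in>I. f i (z + t *s v))) has_field_derivative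
          (f i (z + t *s v) * (\<Prod>i\<in>I. f i (z + t *s v))) *
          (dir_deriv v (f i) (z + t *s v) / f i (z + t *s v)
            + (\<Sum>i\<in>I. dir_deriv v (f i) (z + t *s v) / f i (z + t *s v)))) (at t)"
    by (rule DERIV_cong) (use assms(3)[of i "z + t *s v"] in \<open>simp add: distrib_left\<close>)
  then show ?case using insert.hyps by simp
qed auto

text \<open>The product does not change along any of the directions \<open>v j\<close>, and a
  path made of segments in these directions joins any two points.\<close>
lemma prod_constant_of_log_derivs_cancel:
  fixes f :: "'i \<Rightarrow> complex ^ 'n \<Rightarrow> complex" and v :: "'j::finite \<Rightarrow> complex ^ 'n"
  assumes "finite I" "\<And>i. line_holomorphic (f i)" "\<And>i z. f i z \<noteq> 0"
    and sum0: "\<And>j z. (\<Sum>i\<in>I. dir_deriv (v j) (f i) z / f i z) = 0"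
    and span: "\<And>w. \<exists>c. w = (\<Sum>j\<in>UNIV. c j *s v j)"
  shows "(\<Prod>i\<in>I. f i z) = (\<Prod>i\<in>I. f i z')"
proof -
  define P where "P = (\<lambda>z. \<Prod>i\<in>I. f i z)"
  have step: "P (z + c *s v j) = P z" for z c j
  proof -
    have "((\<lambda>t. P (z + t *s v j)) has_field_derivative 0) (at t within UNIV)" for t
      using dir_deriv_prod[OF assms(1), of f z "v j" t] assms(2,3) sum0[of j "z + t *s v j"]
      unfolding P_def by simp
    then obtain k where "\<And>t. P (z + t *s v j) = k"
      using has_field_derivative_zero_constant[of UNIV "\<lambda>t. P (z + t *s v j)"] by auto
    from this[of c] this[of 0] show ?thesis by simp
  qed
  obtain c where c: "z - z' = (\<Sum>j\<in>UNIV. c j *s v j)" using span by blast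
  have "P (z' + (\<Sum>j\<in>J. c j *s v j)) = P z'" if "finite J" for J
    using that
  proof (induction J)
    case (insert j J)
    have "P (z' + (\<Sum>j\<in>insert j J. c j *s v j)) = P ((z' + (\<Sum>j\<in>J. c j *s v j)) + c j *s v j)"
      using insert.hyps by (simp add: add_ac)
    then show ?case using step insert.IH by simp
  qed auto
  from this[of UNIV] show ?thesis unfolding c[symmetric] P_def by simp
qed

text \<open>The factor \<open>N\<close> is the length of a path. It must not depend on
  \<open>x\<close> or \<open>Q\<close>, because the lemma is used with
  \<open>x i = ln \<bar>f i z\<bar>\<close> for all points \<open>z\<close> at once.\<close>
lemma abs_diff_le_along_path:
  assumes "(i, j) \<in> E\<^sup>*"
  shows "\<exists>N::nat. \<forall>(x :: 'i \<Rightarrow> real) Q. (\<forall>(a, b) \<in> E. \<bar>x a - x b\<bar> \<le> Q) \<longrightarrow> \<bar>x i - x j\<bar> \<le> real N * Q"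
  using assms
proof (induction rule: rtrancl_induct)
  case base
  show ?case by (intro exI[of _ 0]) auto
next
  case (step j k)
  then obtain N where N: "\<And>(x :: 'i \<Rightarrow> real) Q. (\<forall>(a, b) \<in> E. \<bar>x a - x b\<bar> \<le> Q) \<Longrightarrow> \<bar>x i - x j\<bar> \<le> real N * Q"
    by blast
  show ?case
  proof (intro exI[of _ "Suc N"] allI impI)
    fix x :: "'i \<Rightarrow> real" and Q assume *: "\<forall>(a, b) \<in> E. \<bar>x a - x b\<bar> \<le> Q"
    have "\<bar>x j - x k\<bar> \<le> Q" using * step.hyps by auto
    with N[OF *] show "\<bar>x i - x k\<bar> \<le> real (Suc N) * Q" by (simp add: algebra_simps)
  qed
qed

section \<open>Symmetric systems of zero-free functions\<close>

definition log_deriv ::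
  "('i \<Rightarrow> complex ^ 'n) \<Rightarrow> ('i \<Rightarrow> complex ^ 'n \<Rightarrow> complex) \<Rightarrow> 'i \<Rightarrow> 'i \<Rightarrow> complex ^ 'n \<Rightarrow> complex" where
  "log_deriv v f i j z = dir_deriv (v j) (f i) z / f i z"

text \<open>The edges are the pairs for which
  \<open>f i / f j = log_deriv v f j i / log_deriv v f i j\<close> is a quotient of functions
  that do not vanish identically, so that \<open>f i\<close> and \<open>f j\<close> can be
  compared directly.\<close>
definition coupling ::
  "('i \<Rightarrow> complex ^ 'n) \<Rightarrow> ('i \<Rightarrow> complex ^ 'n \<Rightarrow> complex) \<Rightarrow> ('i \<times> 'i) set" where
  "coupling v f = {(i, j). \<exists>z. log_deriv v f i j z \<noteq> 0}"

text \<open>The factors of the equation, freed from the function that they are derivatives of.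
  The assumption \<open>sym\<close> is all that remains of the fact that they come from a common
  potential.\<close>
locale symmetric_unit_system =
  fixes f :: "'i::finite \<Rightarrow> complex ^ 'n \<Rightarrow> complex" and v :: "'i \<Rightarrow> complex ^ 'n"
  assumes hol: "\<And>i. line_holomorphic (f i)"
    and nz: "\<And>i z. f i z \<noteq> 0"
    and sym: "\<And>i j z. dir_deriv (v j) (f i) z = dir_deriv (v i) (f j) z"
    and prod1: "\<And>z. (\<Prod>i\<in>UNIV. f i z) = 1"
    and span: "\<And>w. \<exists>c. w = (\<Sum>j\<in>UNIV. c j *s v j)"
begin

abbreviation "L \<equiv> log_deriv v f"
abbreviation "E \<equiv> coupling v f"

lemma L_sym: "L i j z * f i z = L j i z * f j z"
  using nz sym[of j i] by (simp add: log_deriv_def)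

lemma E_sym: "(i, j) \<in> E \<Longrightarrow> (j, i) \<in> E"
proof -
  assume "(i, j) \<in> E"
  then obtain z where "L i j z \<noteq> 0" by (auto simp: coupling_def)
  then have "L j i z \<noteq> 0" using L_sym[of i j z] nz[of i z] by auto
  then show ?thesis by (auto simp: coupling_def)
qed

lemma L_hol: "line_holomorphic (L i j)"
  unfolding log_deriv_def[abs_def]
  by (intro line_holomorphic_divide line_holomorphic_dir_deriv hol nz)

lemma sum_L_zero: "(\<Sum>i\<in>UNIV. L i j z) = 0"
proof -
  have "((\<lambda>t. \<Prod>i\<in>UNIV. f i (z + t *s v j)) has_field_derivative
      (\<Prod>i\<in>UNIV. f i (z + 0 *s v j)) * (\<Sum>i\<in>UNIV. L i j (z + 0 *s v j))) (at 0)"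
    unfolding log_deriv_def by (intro dir_deriv_prod hol nz finite)
  then have "((\<lambda>t. 1) has_field_derivative (\<Sum>i\<in>UNIV. L i j z)) (at 0)"
    unfolding prod1 by simp
  then show ?thesis by (rule DERIV_unique) simp
qed

text \<open>In a direction \<open>v j\<close> with \<open>j\<close> in the component, the
  logarithmic derivatives of the other factors vanish, so those of the component add up to the
  logarithmic derivative of the full product, which is 0. In a direction with \<open>j\<close>
  outside, each factor of the component is stationary.\<close>
lemma component_prod_constant:
  "(\<Prod>k\<in>E\<^sup>* `` {i}. f k z) = (\<Prod>k\<in>E\<^sup>* `` {i}. f k z')"
proof (rule prod_constant_of_log_derivs_cancel[where v = v])
  fix j z
  let ?C = "E\<^sup>* `` {i}"
  show "(\<Sum>k\<in>?C. dir_deriv (v j) (f k) z / f k z) = 0"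
  proof (cases "j \<in> ?C")
    case True
    have "L k j z = 0" if "k \<notin> ?C" for k
    proof (rule ccontr)
      assume "L k j z \<noteq> 0"
      then have "(j, k) \<in> E" using E_sym by (auto simp: coupling_def)
      with True that show False by (auto intro: rtrancl_into_rtrancl)
    qed
    then have "(\<Sum>k\<in>?C. L k j z) = (\<Sum>k\<in>UNIV. L k j z)"
      by (intro sum.mono_neutral_left) auto
    then show ?thesis unfolding sum_L_zero by (simp add: log_deriv_def)
  next
    case False
    have "L k j z = 0" if "k \<in> ?C" for k
    proof (rule ccontr)
      assume "L k j z \<noteq> 0"
      then have "(k, j) \<in> E" by (auto simp: coupling_def)
      with False that show False by (auto intro: rtrancl_into_rtrancl)
    qed
    then have "(\<Sum>k\<in>?C. L k j z) = 0" by (intro sum.neutral) blast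
    then show ?thesis by (simp only: log_deriv_def)
  qed
qed (use hol nz span in auto)

definition total_log :: "complex ^ 'n \<Rightarrow> real" where
  "total_log z = (\<Sum>i\<in>UNIV. \<bar>ln (cmod (f i z))\<bar>)"

lemma abs_ln_le_total_log: "\<bar>ln (cmod (f i z))\<bar> \<le> total_log z"
  unfolding total_log_def by (rule member_le_sum) auto

text \<open>Averaging over a component \<open>C\<close> turns differences into values:
  \<open>\<bar>C\<bar> x\<^sub>i = \<Sum>\<^bsub>j\<in>C\<^esub> x\<^sub>j + \<Sum>\<^bsub>j\<in>C\<^esub> (x\<^sub>i - x\<^sub>j)\<close>,
  where for \<open>x\<^sub>j = ln \<bar>f\<^sub>j z\<bar>\<close> the first sum does not depend
  on \<open>z\<close>.\<close>
lemma total_log_le_of_differences: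
  "\<exists>A\<ge>0. \<forall>z Q. 0 \<le> Q \<longrightarrow> (\<forall>(i, j)\<in>E. \<bar>ln (cmod (f i z)) - ln (cmod (f j z))\<bar> \<le> Q) \<longrightarrow>
           total_log z \<le> A * (1 + Q)"
proof -
  let ?C = "\<lambda>i. E\<^sup>* `` {i}"
  define N :: "'i \<Rightarrow> 'i \<Rightarrow> nat" where "N = (\<lambda>i j. SOME N. \<forall>(x :: 'i \<Rightarrow> real) Q.
      (\<forall>(a, b) \<in> E. \<bar>x a - x b\<bar> \<le> Q) \<longrightarrow> \<bar>x i - x j\<bar> \<le> real N * Q)"
  have N: "\<bar>x i - x j\<bar> \<le> real (N i j) * Q"
    if "(i, j) \<in> E\<^sup>*" "\<forall>(a, b) \<in> E. \<bar>x a - x b\<bar> \<le> Q" for i j and x :: "'i \<Rightarrow> real" and Q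
    using someI_ex[OF abs_diff_le_along_path[OF that(1)]] that(2) unfolding N_def by blast
  define c where "c = (\<lambda>i. \<bar>ln (cmod (\<Prod>k\<in>?C i. f k 0))\<bar>)"
  define A where "A = (\<Sum>i\<in>UNIV. c i + (\<Sum>j\<in>?C i. real (N i j)))"
  have A0: "0 \<le> A" unfolding A_def c_def by (intro sum_nonneg add_nonneg_nonneg) auto
  have "total_log z \<le> A * (1 + Q)"
    if Q: "0 \<le> Q" "\<forall>(i, j)\<in>E. \<bar>ln (cmod (f i z)) - ln (cmod (f j z))\<bar> \<le> Q" for z Q
  proof -
    define x where "x = (\<lambda>i. ln (cmod (f i z)))"
    have xQ: "\<forall>(i, j)\<in>E. \<bar>x i - x j\<bar> \<le> Q" using Q(2) unfolding x_def .
    have "\<bar>x i\<bar> \<le> (c i + (\<Sum>j\<in>?C i. real (N i j))) * (1 + Q)" for i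
    proof -
      have ne: "?C i \<noteq> {}" by auto
      have "(\<Sum>j\<in>?C i. x j) = ln (cmod (\<Prod>k\<in>?C i. f k z))"
        unfolding x_def prod_norm[symmetric] using nz by (subst ln_prod) auto
      then have s: "\<bar>\<Sum>j\<in>?C i. x j\<bar> = c i"
        unfolding c_def using component_prod_constant[where i = i and z = z and z' = 0] by simp
      have "real (card (?C i)) * x i = (\<Sum>j\<in>?C i. x j) + (\<Sum>j\<in>?C i. x i - x j)"
        by (simp add: sum_subtractf)
      then have "\<bar>real (card (?C i)) * x i\<bar> \<le> c i + (\<Sum>j\<in>?C i. \<bar>x i - x j\<bar>)"
        using s sum_abs[of "\<lambda>j. x i - x j" "?C i"] by linarith
      also have "\<dots> \<le> c i + (\<Sum>j\<in>?C i. real (N i j) * Q)"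
        using N[OF _ xQ] by (intro add_left_mono sum_mono) auto
      also have "\<dots> = c i + (\<Sum>j\<in>?C i. real (N i j)) * Q" by (simp add: sum_distrib_right)
      also have "\<dots> \<le> c i * (1 + Q) + (\<Sum>j\<in>?C i. real (N i j)) * (1 + Q)"
        using Q(1) unfolding c_def by (intro add_mono mult_left_mono mult_right_le_one_le) (auto simp: algebra_simps sum_nonneg)
      finally have "\<bar>real (card (?C i)) * x i\<bar> \<le> (c i + (\<Sum>j\<in>?C i. real (N i j))) * (1 + Q)"
        by (simp add: algebra_simps)
      moreover have "1 \<le> real (card (?C i))"
        using ne by (simp add: Suc_le_eq card_gt_0_iff)
      then have "1 * \<bar>x i\<bar> \<le> real (card (?C i)) * \<bar>x i\<bar>" by (intro mult_right_mono) auto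
      ultimately show ?thesis by (simp add: abs_mult)
    qed
    then show ?thesis unfolding total_log_def A_def x_def sum_distrib_right by (intro sum_mono)
  qed
  with A0 show ?thesis by blast
qed

lemma continuous_total_log: "continuous_on S total_log"
  unfolding total_log_def[abs_def] using nz
  by (intro continuous_intros line_holomorphic_continuous[OF hol]) auto

definition max_log :: "complex ^ 'n \<Rightarrow> real \<Rightarrow> real" where
  "max_log z0 r = 1 + (SUP z\<in>cball z0 r. total_log z)"

lemma bdd_above_total_log: "bdd_above (total_log ` cball z0 r)"
  by (intro bounded_imp_bdd_above compact_imp_bounded compact_continuous_image
      continuous_total_log compact_cball)

lemma total_log_le_max_log: "z \<in> cball z0 r \<Longrightarrow> 1 + total_log z \<le> max_log z0 r"
  unfolding max_log_def using cSUP_upper[OF _ bdd_above_total_log] by simp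

lemma max_log_ge_1: "0 \<le> r \<Longrightarrow> 1 \<le> max_log z0 r"
  using total_log_le_max_log[of z0 z0 r] by (simp add: total_log_def add_increasing2 order_trans[rotated] sum_nonneg)

lemma max_log_mono: "0 \<le> r \<Longrightarrow> r \<le> s \<Longrightarrow> max_log z0 r \<le> max_log z0 s"
  unfolding max_log_def by (intro add_left_mono cSUP_subset_mono bdd_above_total_log) auto

lemma ex_coupled_base_point: "\<exists>z0. \<forall>(i, j)\<in>E. L i j z0 \<noteq> 0"
proof -
  have "\<exists>z0. \<forall>p\<in>E. L (fst p) (snd p) z0 \<noteq> 0"
    by (rule ex_common_nonzero) (auto simp: coupling_def L_hol)
  then show ?thesis unfolding split_beta .
qed

text \<open>Three nested balls are used. The values of \<open>ln \<bar>f i\<bar>\<close> on the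
  ball of radius \<open>r (1 + 2\<sigma>)\<close> bound the \<open>L i j\<close> on the one of
  radius \<open>r (1 + \<sigma>)\<close>, and the logarithm of that bound controls the
  differences \<open>ln \<bar>f i\<bar> - ln \<bar>f j\<bar>\<close> on the one of radius
  \<open>r\<close>. The loss is \<open>1/\<sigma>\<close>, once inside a logarithm and once as a
  factor.\<close>
lemma max_log_growth:
  assumes z0: "\<forall>(i, j)\<in>E. L i j z0 \<noteq> 0"
  shows "\<exists>K\<ge>0. \<forall>r \<sigma>. 1 \<le> r \<longrightarrow> 0 < \<sigma> \<longrightarrow> \<sigma> \<le> 1 \<longrightarrow>
      \<sigma> * max_log z0 r \<le> K * (ln (max_log z0 (r * (1 + 2 * \<sigma>))) + ln (1 / \<sigma>) + 1)"
proof -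
  obtain A where A: "0 \<le> A" "\<And>z Q. 0 \<le> Q \<Longrightarrow>
      (\<forall>(i, j)\<in>E. \<bar>ln (cmod (f i z)) - ln (cmod (f j z))\<bar> \<le> Q) \<Longrightarrow> total_log z \<le> A * (1 + Q)"
    using total_log_le_of_differences by blast
  define V where "V = 1 + (\<Sum>j\<in>UNIV. norm (v j))"
  have V: "1 \<le> V" "norm (v j) \<le> V" for j
    unfolding V_def by (auto simp: sum_nonneg intro!: add_increasing member_le_sum)
  define k0 where "k0 = (\<Sum>(i, j)\<in>UNIV. \<bar>ln (cmod (L i j z0))\<bar>)"
  have k0: "\<bar>ln (cmod (L i j z0))\<bar> \<le> k0" for i j
    unfolding k0_def split_beta
    by (rule member_le_sum[of "(i, j)" UNIV "\<lambda>p. \<bar>ln (cmod (L (fst p) (snd p) z0))\<bar>", simplified])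
  have k00: "0 \<le> k0" using k0 by (rule order_trans[OF abs_ge_zero])
  define K1 where "K1 = 2 + ln V + k0"
  have K1: "1 \<le> K1" using V(1) k00 unfolding K1_def by simp
  define K where "K = 1 + A + 3 * A * K1"
  have "\<sigma> * max_log z0 r \<le> K * (ln (max_log z0 (r * (1 + 2 * \<sigma>))) + ln (1 / \<sigma>) + 1)"
    if r: "1 \<le> r" and \<sigma>: "0 < \<sigma>" "\<sigma> \<le> 1" for r \<sigma>
  proof -
    define B where "B = max_log z0 (r * (1 + 2 * \<sigma>))"
    have B: "1 \<le> B" unfolding B_def using r \<sigma> by (intro max_log_ge_1) auto
    \<comment> \<open>Moving by \<open>t *s v j\<close> with
        \<open>\<bar>t\<bar> \<le> \<rho>\<close> changes the distance to \<open>z0\<close> by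
        at most \<open>r \<sigma>\<close>.\<close>
    define \<rho> where "\<rho> = r * \<sigma> / V"
    have \<rho>: "0 < \<rho>" unfolding \<rho>_def using r \<sigma> V by simp
    define M where "M = exp 2 * B / \<rho>"
    define T where "T = ln B + ln (1 / \<sigma>) + 1"
    have T: "1 \<le> T" unfolding T_def using B \<sigma> by simp
    have lnM: "ln M + k0 \<le> K1 * T"
    proof -
      have "ln M = 2 + ln B + ln V + ln (1 / \<sigma>) - ln r"
        unfolding M_def \<rho>_def using B V r \<sigma> by (simp add: ln_mult ln_div)
      also have "\<dots> \<le> 2 + ln V + (T - 1)" using r unfolding T_def by simp
      finally have "ln M + k0 \<le> K1 + 1 * (T - 1)" unfolding K1_def by simp
      also have "\<dots> \<le> K1 + K1 * (T - 1)" using K1 T by (intro add_left_mono mult_right_mono) auto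
      finally show ?thesis by (simp add: algebra_simps)
    qed
    have LM: "cmod (L i j z) \<le> M" if z: "z \<in> cball z0 (r * (1 + \<sigma>))" for i j z
      unfolding log_deriv_def M_def
    proof (rule norm_log_deriv_le)
      show "\<bar>ln (cmod (f i (z + t *s v j)))\<bar> \<le> B" if t: "cmod t \<le> \<rho>" for t
      proof -
        have "cmod t * norm (v j) \<le> \<rho> * V" using t V \<rho> by (intro mult_mono) auto
        then have "norm (t *s v j) \<le> r * \<sigma>" unfolding \<rho>_def norm_vector_scalar_mult using V by simp
        then have "dist z0 (z + t *s v j) \<le> r * (1 + \<sigma>) + r * \<sigma>"
          using z norm_triangle_ineq4[of "z0 - z" "t *s v j"] by (simp add: dist_norm algebra_simps)
        then have "1 + total_log (z + t *s v j) \<le> B"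
          unfolding B_def by (intro total_log_le_max_log) (simp add: algebra_simps)
        then show ?thesis using abs_ln_le_total_log[of i "z + t *s v j"] by simp
      qed
    qed (use hol nz \<rho> B in auto)
    define Q where "Q = 3 / \<sigma> * (K1 * T)"
    have Q: "0 \<le> Q" unfolding Q_def using \<sigma> K1 T by simp
    have "total_log z \<le> A * (1 + Q)" if z: "z \<in> cball z0 r" for z
    proof (rule A(2)[OF Q], safe)
      have le: "ln (cmod (f i z)) - ln (cmod (f j z)) \<le> Q" if "(i, j) \<in> E" for i j
      proof -
        have "ln (cmod (f i z)) - ln (cmod (f j z)) \<le> 3 / \<sigma> * (ln M - ln (cmod (L i j z0)))"
          using z0 that LM
          by (intro ln_norm_diff_le[OF L_hol hol hol nz nz L_sym \<sigma> z]) auto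
        also have "\<dots> \<le> Q" unfolding Q_def
          using lnM k0[of i j] \<sigma> by (intro mult_left_mono) auto
        finally show ?thesis .
      qed
      fix i j assume "(i, j) \<in> E"
      then show "\<bar>ln (cmod (f i z)) - ln (cmod (f j z))\<bar> \<le> Q"
        using le[of i j] le[OF E_sym, of i j] by simp
    qed
    then have "max_log z0 r \<le> 1 + A * (1 + Q)"
      unfolding max_log_def using r by (intro add_left_mono cSUP_least) auto
    then have "\<sigma> * max_log z0 r \<le> \<sigma> * (1 + A * (1 + Q))" using \<sigma> by (intro mult_left_mono) auto
    also have "\<dots> = \<sigma> * (1 + A) + 3 * A * K1 * T" unfolding Q_def using \<sigma> by (simp add: algebra_simps)
    also have "\<dots> \<le> (1 + A) * T + 3 * A * K1 * T"
    proof -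
      have "\<sigma> * (1 + A) \<le> T * (1 + A)" using \<sigma> T A(1) by (intro mult_right_mono) auto
      then show ?thesis by (simp add: mult.commute)
    qed
    also have "\<dots> = K * T" unfolding K_def by (simp add: algebra_simps)
    finally show ?thesis unfolding T_def B_def .
  qed
  moreover have "0 \<le> K" unfolding K_def using A(1) K1 by simp
  ultimately show ?thesis by blast
qed

lemma factor_constant: "f i z = f i z'"
proof -
  obtain z0 where z0: "\<forall>(i, j)\<in>E. L i j z0 \<noteq> 0" using ex_coupled_base_point by blast
  obtain K where K: "0 \<le> K" "\<And>r \<sigma>. 1 \<le> r \<Longrightarrow> 0 < \<sigma> \<Longrightarrow> \<sigma> \<le> 1 \<Longrightarrow>
      \<sigma> * max_log z0 r \<le> K * (ln (max_log z0 (r * (1 + 2 * \<sigma>))) + ln (1 / \<sigma>) + 1)"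
    using max_log_growth[OF z0] by blast
  have "\<exists>M. \<forall>r\<ge>1. max_log z0 r \<le> M"
  proof (rule bounded_of_logarithmic_growth_estimate[OF _ K(1) _ K(2)])
    show "max_log z0 r \<le> max_log z0 s" if "1 \<le> r" "r \<le> s" for r s
      using that by (intro max_log_mono) auto
    show "0 < max_log z0 r" if "1 \<le> r" for r
      using max_log_ge_1[of r z0] that by simp
  qed
  then obtain M where M: "\<And>r. 1 \<le> r \<Longrightarrow> max_log z0 r \<le> M" by blast
  have bd: "cmod (f i z) \<le> exp M" for z
  proof -
    have "1 + total_log z \<le> max_log z0 (1 + dist z0 z)"
      by (rule total_log_le_max_log) simp
    also have "\<dots> \<le> M" by (rule M) simp
    finally have "ln (cmod (f i z)) \<le> M" using abs_ln_le_total_log[of i z] by linarith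
    then have "exp (ln (cmod (f i z))) \<le> exp M" by simp
    then show ?thesis using nz by simp
  qed
  have "(\<lambda>t. f i (z' + t *s (z - z'))) constant_on UNIV"
    using bd by (intro Liouville_theorem line_holomorphic_line hol) (auto simp: bounded_iff)
  then obtain k where "\<And>t. f i (z' + t *s (z - z')) = k" by (auto simp: constant_on_def)
  from this[of 0] this[of 1] show ?thesis by simp
qed

end

section \<open>The product equation for the gradient\<close>

theorem theorem1:
  fixes A :: "complex ^ 'n ^ 'n" and u :: "complex ^ 'n \<Rightarrow> complex"
  assumes "det A \<noteq> 0"
    and "entire u"
    and "\<And>z. (\<Prod>i\<in>UNIV. \<Sum>j\<in>UNIV. A $ i $ j * partial_deriv j u z) = 1"
  shows "linear_function u"
proof -
  obtain D where D: "\<And>z. (u has_derivative D z) (at z)" and Dc: "\<And>z c v. D z (c *s v) = c * D z v"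
    using assms(2) unfolding entire_def choice_iff by blast
  have Dline: "((\<lambda>t. u (z + t *s v)) has_field_derivative D (z + t *s v) v) (at t)" for z v t
  proof -
    have "((\<lambda>t. z + t *s v) has_derivative (\<lambda>s. s *s v)) (at t)"
    proof -
      have "bounded_linear (\<lambda>s. s *s v)"
        by (rule bounded_linear_intro[where K = "norm v"])
          (simp_all add: norm_vector_scalar_mult vector_sadd_rdistrib vec_eq_iff)
      from has_derivative_add[OF has_derivative_const bounded_linear_imp_has_derivative[OF this]]
      show ?thesis by simp
    qed
    from diff_chain_at[OF this D]
    have "((\<lambda>t. u (z + t *s v)) has_derivative (\<lambda>s. D (z + t *s v) (s *s v))) (at t)"
      by (simp add: o_def)
    then show ?thesis
      unfolding has_field_derivative_def Dc by (simp add: mult.commute[of _ "D _ _"])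
  qed
  have cont: "continuous_on UNIV u"
    using D by (meson continuous_at_imp_continuous_on has_derivative_continuous)
  have u: "line_holomorphic u"
    unfolding line_holomorphic_def using cont Dline
    by (auto simp: holomorphic_on_open)
  have dir: "dir_deriv w u z = D z w" for w z
    using Dline[of z w 0] unfolding dir_deriv_def by (simp add: DERIV_imp_deriv)
  have partial: "partial_deriv j u z = D z (axis j 1)" for j z
  proof -
    have "(\<chi> k. if k = j then t else z $ k) = z + (t - z $ j) *s axis j 1" for t
      by (simp add: vec_eq_iff axis_def)
    then have eq: "(\<lambda>t. u (\<chi> k. if k = j then t else z $ k)) = (\<lambda>t. u (z + (t - z $ j) *s axis j 1))"
      by simp
    have outer: "((\<lambda>t. u (z + t *s axis j 1)) has_field_derivative D z (axis j 1)) (at (z $ j - z $ j))"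
      using Dline[of z "axis j 1" 0] by simp
    have "((\<lambda>t. t - z $ j) has_field_derivative 1) (at (z $ j))"
      by (auto intro!: derivative_eq_intros)
    from DERIV_chain2[where f = "\<lambda>t. u (z + t *s axis j 1)", OF outer this]
    have "((\<lambda>t. u (z + (t - z $ j) *s axis j 1)) has_field_derivative D z (axis j 1)) (at (z $ j))"
      by (simp only: mult_1_right)
    then show ?thesis unfolding partial_deriv_def eq by (rule DERIV_imp_deriv)
  qed
  have lin: "linear (D z)" for z using D has_derivative_linear by blast
  have Dexp: "D z w = (\<Sum>j\<in>UNIV. w $ j * D z (axis j 1))" for z w
  proof -
    have "D z w = D z (\<Sum>j\<in>UNIV. w $ j *s axis j 1)" by (simp add: basis_expansion)
    also have "\<dots> = (\<Sum>j\<in>UNIV. w $ j * D z (axis j 1))"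
      by (simp add: linear_sum[OF lin] Dc)
    finally show ?thesis .
  qed
  define f where "f = (\<lambda>i. dir_deriv (A $ i) u)"
  have f: "f i z = (\<Sum>j\<in>UNIV. A $ i $ j * partial_deriv j u z)" for i z
    unfolding f_def dir partial by (rule Dexp)
  interpret symmetric_unit_system f "\<lambda>i. A $ i"
  proof
    show "line_holomorphic (f i)" for i unfolding f_def by (rule line_holomorphic_dir_deriv[OF u])
    show prod1: "(\<Prod>i\<in>UNIV. f i z) = 1" for z unfolding f by (rule assms(3))
    show "f i z \<noteq> 0" for i z
    proof
      assume "f i z = 0"
      then have "(\<Prod>i\<in>UNIV. f i z) = 0" by (intro prod_zero) auto
      then show False using prod1[of z] by simp
    qed
    show "dir_deriv (A $ j) (f i) z = dir_deriv (A $ i) (f j) z" for i j z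
      unfolding f_def by (rule dir_deriv_commute[OF u])
    show "\<exists>c. w = (\<Sum>j\<in>UNIV. c j *s A $ j)" for w
    proof -
      obtain B where B: "B ** A = mat 1"
        using assms(1) invertible_det_nz[of A] unfolding invertible_def by blast
      have "w = w v* (B ** A)" by (simp add: B)
      also have "\<dots> = (w v* B) v* A" by (simp add: vector_matrix_mul_assoc)
      also have "\<dots> = (\<Sum>j\<in>UNIV. (w v* B) $ j *s A $ j)"
        by (simp add: vec_eq_iff vector_matrix_mult_def mult.commute)
      finally show ?thesis by blast
    qed
  qed
  \<comment> \<open>The factors are the matrix times the gradient, so invertibility makes the
      gradient constant.\<close>
  define p where "p = (\<lambda>z. \<chi> j. D z (axis j 1))"
  have Ap: "A *v p z = A *v p 0" for z
  proof -
    have "(A *v p z) $ i = f i z" for i z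
      unfolding f partial by (simp add: matrix_vector_mult_def p_def)
    then show ?thesis using factor_constant[of _ z 0] by (simp add: vec_eq_iff)
  qed
  obtain B where B: "B ** A = mat 1"
    using assms(1) invertible_det_nz[of A] unfolding invertible_def by blast
  have p: "p z = p 0" for z
    using arg_cong[OF Ap[of z], of "\<lambda>w. B *v w"] by (simp add: matrix_vector_mul_assoc B)
  have Dp: "D z w = D 0 w" for z w
    unfolding Dexp[of z w] Dexp[of 0 w] using p[of z] by (simp add: p_def vec_eq_iff)
  have "((\<lambda>z. u z - D 0 z) has_derivative (\<lambda>w. 0)) (at z)" for z
  proof -
    have "bounded_linear (D 0)" using D has_derivative_bounded_linear by blast
    from has_derivative_diff[OF D[of z] bounded_linear_imp_has_derivative[OF this]]
    show ?thesis unfolding Dp[of z] by simp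
  qed
  then obtain c0 where "\<And>z. u z - D 0 z = c0"
    using has_derivative_zero_constant[of UNIV "\<lambda>z. u z - D 0 z"] by auto
  then have "u z = c0 + (\<Sum>j\<in>UNIV. p 0 $ j * z $ j)" for z
    unfolding p_def using Dexp[of 0 z] by (simp add: algebra_simps)
  then show ?thesis unfolding linear_function_def by blast
qed

end
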